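(* Let $q=q_1q_2\cdots q_k$ be a skew indecomposable pattern such that at least one of the following conditions holds: (1) $q_1\neq 1$; or (2) $q_k\neq k$; or (3) $q_1=1$ and $q_k=k$, but $q$ is Wilf-equivalent to a skew indecomposable pattern in which the first entry is not $1$ or the last entry is not $k$. Then the relation $$A_q(z)=\frac{1}{1-A_{1,q}(z)}$$ is not supercritical.
   Context: A permutation of length $n$ is written in one-line notation $p=p_1p_2\cdots p_n$ as an ordering of $1,2,\dots,n$. A pattern $q=q_1\cdots q_k$ is a permutation of length $k$. A permutation $p$ contains $q$ if there are indices $i_1<i_2<\cdots<i_k$ such that for all $r,s$, $p_{i_r}<p_{i_s}$ if and only if $q_r<q_s$; otherwise $p$ avoids $q$. $\mathrm{Av}_n(q)$ is the number of permutations of length $n$ that avoid $q$ (with $\mathrm{Av}_0(q)=1$, counting the empty permutation). Two patterns $q$ and $q'$ (of the same length $k$) are Wilf-equivalent if $\mathrm{Av}_n(q)=\mathrm{Av}_n(q')$ for all $n\ge 1$. A nonempty permutation $p$ is skew indecomposable if it cannot be cut into two nonempty parts (an initial segment and the remaining final segment) so that each entry before the cut is larger than each entry after the cut. $\mathrm{Av}_{n,1}(q)$ is the number of skew indecomposable $q$-avoiding permutations of length $n$. Generating functions: $A_q(z)=\sum_{n\ge 0}\mathrm{Av}_n(q)z^n$ and $A_{1,q}(z)=\sum_{n\ge 1}\mathrm{Av}_{n,1}(q)z^n$. For skew indecomposable $q$ one has $A_q(z)=1/(1-A_{1,q}(z))$. Supercritical: let $F$ and $G$ be two generating functions with nonnegative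 real coefficients that are analytic at $0$, with $G(0)=0$. The relation $F(z)=\frac{1}{1-G(z)}$ is called supercritical if $G(R_G)>1$, where $R_G$ is the radius of convergence of $G$; here $G(R_G)\in[0,\infty]$ is understood as the limit of $G(x)$ as $x\to R_G$ from the left along the real axis ($R_G=\infty$ allowed). *)

theory Defs
  imports "HOL-Analysis.Analysis" "HOL-Combinatorics.Multiset_Permutations"
begin

text \<open>
  Permutations of length \<open>n\<close> are given in one-line notation: they are the lists in
  \<^term>\<open>permutations_of_set {1..n}\<close>, with entries counted from 1 and positions from 0.
\<close>

definition contains_pattern :: "nat list \<Rightarrow> nat list \<Rightarrow> bool" where
  "contains_pattern p q \<longleftrightarrow>
     (\<exists>i. strict_mono_on {..<length q} i \<and> i ` {..<length q} \<subseteq> {..<length p} \<and>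
          (\<forall>r<length q. \<forall>s<length q. p ! i r < p ! i s \<longleftrightarrow> q ! r < q ! s))"

definition skew_indecomposable :: "nat list \<Rightarrow> bool" where
  "skew_indecomposable p \<longleftrightarrow>
     p \<noteq> [] \<and>
     \<not> (\<exists>u v. p = u @ v \<and> u \<noteq> [] \<and> v \<noteq> [] \<and> (\<forall>x\<in>set u. \<forall>y\<in>set v. x > y))"

definition Av :: "nat \<Rightarrow> nat list \<Rightarrow> nat" where
  "Av n q = card {p \<in> permutations_of_set {1..n}. \<not> contains_pattern p q}"

definition Av1 :: "nat \<Rightarrow> nat list \<Rightarrow> nat" where
  "Av1 n q = card {p \<in> permutations_of_set {1..n}.
                     \<not> contains_pattern p q \<and> skew_indecomposable p}"

definition wilf_equivalent :: "nat list \<Rightarrow> nat list \<Rightarrow> bool" where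
  "wilf_equivalent q q' \<longleftrightarrow> length q = length q' \<and> (\<forall>n\<ge>1. Av n q = Av n q')"

definition A_gf :: "nat list \<Rightarrow> real fps" where
  "A_gf q = Abs_fps (\<lambda>n. real (Av n q))"

text \<open>
  The constant coefficient of the following series is 0, since the empty list is not
  skew indecomposable.
\<close>

definition A1_gf :: "nat list \<Rightarrow> real fps" where
  "A1_gf q = Abs_fps (\<lambda>n. real (Av1 n q))"

text \<open>
  \<open>G(R)\<close>, where \<open>R\<close> is the radius of convergence of \<open>G\<close>: the limit in \<open>[-\<infinity>, \<infinity>]\<close> of \<open>G(x)\<close>
  as \<open>x\<close> tends to \<open>R\<close> from the left. The variable \<open>x\<close> ranges over the extended reals in order
  that \<open>R = \<infinity>\<close> be covered; near \<open>R > 0\<close> from the left it is always finite.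
\<close>

definition value_at_radius :: "real fps \<Rightarrow> ereal" where
  "value_at_radius G =
     Lim (at_left (fps_conv_radius G)) (\<lambda>x. ereal (eval_fps G (real_of_ereal x)))"

text \<open>
  Supercriticality of the relation \<open>F = 1 / (1 - G)\<close>, a property of \<open>G\<close> alone. It is meant for
  series \<open>G\<close> with nonnegative coefficients and \<open>G(0) = 0\<close> that are analytic at \<open>0\<close>. The
  condition \<^term>\<open>fps_conv_radius G > 0\<close> states this analyticity; without it there is no
  limit from the left to speak of.
\<close>

definition supercritical :: "real fps \<Rightarrow> bool" where
  "supercritical G \<longleftrightarrow> fps_conv_radius G > 0 \<and> value_at_radius G > 1"

end

theory Submission
  imports Defs
begin

text \<open>
  Put \<open>A = A_gf q\<close> and \<open>G = A1_gf q\<close>. Cutting a permutation at its first skew cut gives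
  \<open>A = 1 + G A\<close>. If \<open>q\<close> does not start with its minimum, then putting a new minimum in front of
  a \<open>q\<close>-avoiding permutation keeps it \<open>q\<close>-avoiding and makes it skew indecomposable; if \<open>q\<close> does
  not end with its maximum, one appends a new maximum instead. Hence \<open>Av n q \<le> Av1 (Suc n) q\<close>,
  so \<open>A\<close> converges wherever \<open>G\<close> does. For \<open>0 \<le> x < R\<close>, with \<open>R\<close> the radius of convergence of
  \<open>G\<close>, it follows that \<open>A(x) (1 - G(x)) = 1\<close> with \<open>A(x) \<ge> 0\<close>, and therefore \<open>G(x) < 1\<close>.
  In the Wilf-equivalent case, \<open>G\<close> is determined by \<open>A\<close>.
\<close>

section \<open>Pattern containment\<close>

lemma contains_pattern_appendI1:
  assumes "contains_pattern u q"
  shows "contains_pattern (u @ v) q"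
proof -
  obtain i where i: "strict_mono_on {..<length q} i" "i ` {..<length q} \<subseteq> {..<length u}"
    "\<forall>r<length q. \<forall>s<length q. u ! i r < u ! i s \<longleftrightarrow> q ! r < q ! s"
    using assms unfolding contains_pattern_def by blast
  then have "\<forall>r<length q. i r < length u" by auto
  with i show ?thesis unfolding contains_pattern_def
    by (intro exI[of _ i]) (auto simp: nth_append)
qed

lemma contains_pattern_appendI2:
  assumes "contains_pattern v q"
  shows "contains_pattern (u @ v) q"
proof -
  obtain i where i: "strict_mono_on {..<length q} i" "i ` {..<length q} \<subseteq> {..<length v}"
    "\<forall>r<length q. \<forall>s<length q. v ! i r < v ! i s \<longleftrightarrow> q ! r < q ! s"
    using assms unfolding contains_pattern_def by blast
  then show ?thesis unfolding contains_pattern_def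
    by (intro exI[of _ "\<lambda>r. length u + i r"]) (auto simp: strict_mono_on_def)
qed

text \<open>This is for an explicit occurrence \<open>i\<close> known to stay inside the first
  block; its companion treats one inside the second block, where the positions shift down by
  \<open>length u\<close>.\<close>

lemma contains_pattern_appendD1:
  assumes "strict_mono_on {..<length q} i"
    and "\<And>r. r < length q \<Longrightarrow> i r < length u"
    and "\<forall>r<length q. \<forall>s<length q. (u @ v) ! i r < (u @ v) ! i s \<longleftrightarrow> q ! r < q ! s"
  shows "contains_pattern u q"
  using assms unfolding contains_pattern_def
  by (intro exI[of _ i]) (auto simp: nth_append)

lemma contains_pattern_appendD2:
  assumes "strict_mono_on {..<length q} i"
    and "\<And>r. r < length q \<Longrightarrow> length u \<le> i r \<and> i r < length (u @ v)"
    and "\<forall>r<length q. \<forall>s<length q. (u @ v) ! i r < (u @ v) ! i s \<longleftrightarrow> q ! r < q ! s"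
  shows "contains_pattern v q"
proof -
  have "(u @ v) ! i r = v ! (i r - length u)" if "r < length q" for r
    using assms(2)[OF that] by (simp add: nth_append)
  moreover have "i r - length u < i s - length u" if "r < s" "s < length q" for r s
    using assms(1) assms(2)[of r] that by (simp add: strict_mono_on_def diff_less_mono)
  moreover have "i r - length u < length v" if "r < length q" for r
    using assms(2)[OF that] by auto
  ultimately show ?thesis using assms(3) unfolding contains_pattern_def
    by (intro exI[of _ "\<lambda>r. i r - length u"]) (auto simp: strict_mono_on_def)
qed

lemma contains_pattern_map:
  assumes "strict_mono f"
  shows "contains_pattern (map f p) q \<longleftrightarrow> contains_pattern p q"
proof -
  have "(map f p ! i r < map f p ! i s) = (p ! i r < p ! i s)"
    if "i ` {..<length q} \<subseteq> {..<length p}" "r < length q" "s < length q" for i r s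
  proof -
    have "i r < length p" "i s < length p" using that by auto
    then show ?thesis using assms by (simp add: strict_mono_less)
  qed
  then show ?thesis unfolding contains_pattern_def by (metis length_map)
qed

lemma contains_pattern_Nil_iff: "contains_pattern [] q \<longleftrightarrow> q = []"
  by (auto simp: contains_pattern_def)

text \<open>An occurrence meeting both blocks would cut \<open>q\<close>: its letters in
  \<open>u\<close> come first and exceed those in \<open>v\<close>, so \<open>q\<close> would be
  skew decomposable.\<close>

lemma contains_pattern_skew_append_iff:
  assumes "skew_indecomposable q" "\<forall>x\<in>set u. \<forall>y\<in>set v. x > y"
  shows "contains_pattern (u @ v) q \<longleftrightarrow> contains_pattern u q \<or> contains_pattern v q"
proof
  assume "contains_pattern (u @ v) q"
  then obtain i where mono: "strict_mono_on {..<length q} i"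
    and ran: "i ` {..<length q} \<subseteq> {..<length (u @ v)}"
    and ord: "\<forall>r<length q. \<forall>s<length q. (u @ v) ! i r < (u @ v) ! i s \<longleftrightarrow> q ! r < q ! s"
    unfolding contains_pattern_def by blast
  have ran': "i r < length (u @ v)" if "r < length q" for r
    using ran that by auto
  have mono_le: "i r \<le> i s" if "r \<le> s" "s < length q" for r s
    using mono that by (cases "r = s") (auto simp: strict_mono_on_def less_imp_le)
  show "contains_pattern u q \<or> contains_pattern v q"
  proof (rule ccontr)
    assume neither: "\<not> ?thesis"
    then obtain r1 where r1: "r1 < length q" "length u \<le> i r1"
      using contains_pattern_appendD1[OF mono _ ord] by (meson not_le)
    obtain r0 where r0: "r0 < length q" "i r0 < length u"
      using contains_pattern_appendD2[OF mono _ ord] neither ran' by (meson not_le)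
    \<comment> \<open>The cut of \<open>q\<close> is made at its first letter that is matched inside
      \<open>v\<close>.\<close>
    define m where "m = (LEAST r. r < length q \<and> length u \<le> i r)"
    have m: "m < length q" "length u \<le> i m"
      using LeastI[of "\<lambda>r. r < length q \<and> length u \<le> i r" r1] r1 by (auto simp: m_def)
    have below: "i r < length u" if "r < m" for r
      using not_less_Least[of r "\<lambda>r. r < length q \<and> length u \<le> i r"] that m(1)
      by (auto simp: m_def)
    \<comment> \<open>If \<open>m\<close> were 0, monotonicity would push the whole occurrence into
      \<open>v\<close>, against \<open>r0\<close>.\<close>
    have "m > 0" using m(2) r0 mono_le[of 0 r0] by (cases m) auto
    have "x > y" if x: "x \<in> set (take m q)" and y: "y \<in> set (drop m q)" for x y
    proof -
      obtain r where r: "r < m" "x = q ! r"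
        using x by (auto simp: in_set_conv_nth)
      obtain s' where "s' < length (drop m q)" "y = drop m q ! s'"
        using y by (auto simp: in_set_conv_nth)
      then obtain s where s: "m \<le> s" "s < length q" "y = q ! s"
        using m(1) by (intro that[of "m + s'"]) auto
      have "(u @ v) ! i r \<in> set u" using below[OF r(1)] by (simp add: nth_append)
      moreover have "(u @ v) ! i s \<in> set v"
        using mono_le[OF s(1,2)] m(2) ran'[OF s(2)] by (auto simp: nth_append)
      ultimately have "(u @ v) ! i s < (u @ v) ! i r" using assms(2) by blast
      then show ?thesis using ord r s m(1) by auto
    qed
    moreover have "q = take m q @ drop m q" "take m q \<noteq> []" "drop m q \<noteq> []"
      using \<open>m > 0\<close> m(1) by auto
    ultimately show False
      using assms(1) unfolding skew_indecomposable_def by blast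
  qed
qed (auto intro: contains_pattern_appendI1 contains_pattern_appendI2)

text \<open>The leading minimum could only play the role of the first letter of \<open>q\<close>.
  That letter is not the least one, as \<open>s\<close> witnesses, so every occurrence lies within
  \<open>p\<close>.\<close>

lemma contains_pattern_min_Cons:
  assumes "contains_pattern (x # p) q" "\<forall>y\<in>set p. x < y" "s < length q" "q ! s < q ! 0"
  shows "contains_pattern p q"
proof -
  obtain i where mono: "strict_mono_on {..<length q} i"
    and ran: "i ` {..<length q} \<subseteq> {..<length (x # p)}"
    and ord: "\<forall>r<length q. \<forall>s<length q. (x # p) ! i r < (x # p) ! i s \<longleftrightarrow> q ! r < q ! s"
    using assms(1) unfolding contains_pattern_def by blast
  have ran': "i r < length (x # p)" if "r < length q" for r
    using ran that by auto
  have "(x # p) ! i s < (x # p) ! i 0"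
    using ord assms(3,4) by (metis gr_implies_not0 neq0_conv)
  moreover have "x \<le> (x # p) ! i s"
    using assms(2) ran'[OF assms(3)] by (cases "i s") (auto simp: less_imp_le)
  ultimately have "i 0 > 0" by (cases "i 0") auto
  then have "length [x] \<le> i r" if "r < length q" for r
    using strict_mono_onD[OF mono, of 0 r] that by (cases "r = 0"; cases "q = []") auto
  then show ?thesis
    using contains_pattern_appendD2[of q i "[x]" p] mono ran' ord by auto
qed

text \<open>Dually, the final maximum could only play the last letter of \<open>q\<close>, and the
  letter at \<open>s\<close> is larger than that one.\<close>

lemma contains_pattern_append_max:
  assumes "contains_pattern (p @ [x]) q" "\<forall>y\<in>set p. y < x"
    and "s < length q" "q ! (length q - 1) < q ! s"
  shows "contains_pattern p q"
proof -
  obtain i where mono: "strict_mono_on {..<length q} i"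
    and ran: "i ` {..<length q} \<subseteq> {..<length (p @ [x])}"
    and ord: "\<forall>r<length q. \<forall>s<length q. (p @ [x]) ! i r < (p @ [x]) ! i s \<longleftrightarrow> q ! r < q ! s"
    using assms(1) unfolding contains_pattern_def by blast
  let ?l = "length q - 1"
  have l: "?l < length q" using assms(3) by simp
  have ran': "i r \<le> length p" if "r < length q" for r
    using ran that by (auto simp: less_Suc_eq_le)
  have "(p @ [x]) ! i ?l < (p @ [x]) ! i s" using ord assms(3,4) l by blast
  moreover have "(p @ [x]) ! i s \<le> x"
    using assms(2) ran'[OF assms(3)] by (auto simp: nth_append less_imp_le)
  ultimately have "i ?l \<noteq> length p" by auto
  with ran'[OF l] have "i ?l < length p" by simp
  moreover have "i r \<le> i ?l" if "r < length q" for r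
  proof (cases "r = ?l")
    case False
    with that have "r < ?l" by simp
    with mono l that show ?thesis by (simp add: strict_mono_on_def less_imp_le)
  qed simp
  ultimately show ?thesis
    using contains_pattern_appendD1[of q i p "[x]"] mono ord by (metis le_less_trans)
qed

section \<open>Skew decomposition\<close>

lemma skew_indecomposable_map:
  assumes "strict_mono f"
  shows "skew_indecomposable (map f p) \<longleftrightarrow> skew_indecomposable p"
proof -
  have "(\<exists>u v. map f p = u @ v \<and> u \<noteq> [] \<and> v \<noteq> [] \<and> (\<forall>x\<in>set u. \<forall>y\<in>set v. x > y)) \<longleftrightarrow>
        (\<exists>u v. p = u @ v \<and> u \<noteq> [] \<and> v \<noteq> [] \<and> (\<forall>x\<in>set u. \<forall>y\<in>set v. x > y))"
    (is "?L \<longleftrightarrow> ?R")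
  proof
    assume ?L
    then obtain a b where "p = a @ b" "a \<noteq> []" "b \<noteq> []"
      "\<forall>x\<in>set (map f a). \<forall>y\<in>set (map f b). x > y"
      unfolding map_eq_append_conv by (metis list.map_disc_iff)
    then show ?R using assms
      by (intro exI[of _ a] exI[of _ b]) (auto simp: strict_mono_less)
  next
    assume ?R
    then obtain u v where "p = u @ v" "u \<noteq> []" "v \<noteq> []" "\<forall>x\<in>set u. \<forall>y\<in>set v. x > y"
      by blast
    then show ?L using assms
      by (intro exI[of _ "map f u"] exI[of _ "map f v"]) (auto simp: strict_mono_less)
  qed
  then show ?thesis by (simp add: skew_indecomposable_def)
qed

text \<open>The first part of any cut contains the minimum \<open>x\<close>, which exceeds nothing
  in the second part.\<close>

lemma skew_indecomposable_min_Cons: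
  assumes "\<forall>y\<in>set p. x < y"
  shows "skew_indecomposable (x # p)"
proof -
  have False if uv: "x # p = u @ v" "u \<noteq> []" "v \<noteq> []" "\<forall>a\<in>set u. \<forall>b\<in>set v. a > b" for u v
  proof -
    have "x \<in> set u" using uv(1,2) by (cases u) auto
    moreover have "hd v \<in> set v" using uv(3) by simp
    moreover from this have "hd v \<in> set (x # p)" unfolding uv(1) by simp
    ultimately have "hd v < x" "x \<le> hd v" using uv(4) assms by (auto simp: less_imp_le)
    then show False by simp
  qed
  then show ?thesis unfolding skew_indecomposable_def by blast
qed

lemma skew_indecomposable_append_max:
  assumes "\<forall>y\<in>set p. y < x"
  shows "skew_indecomposable (p @ [x])"
proof -
  have False if uv: "p @ [x] = u @ v" "u \<noteq> []" "v \<noteq> []" "\<forall>a\<in>set u. \<forall>b\<in>set v. a > b" for u v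
  proof -
    have "last v = x" using arg_cong[OF uv(1), of last] uv(3) by simp
    then have "x \<in> set v" using uv(3) by (metis last_in_set)
    moreover have "hd u \<in> set u" using uv(2) by simp
    moreover from this have "hd u \<in> set (p @ [x])" unfolding uv(1) by simp
    ultimately have "x < hd u" "hd u \<le> x" using uv(4) assms by (auto simp: less_imp_le)
    then show False by simp
  qed
  then show ?thesis unfolding skew_indecomposable_def by blast
qed

text \<open>The shortest nonempty prefix that dominates the rest works: a skew cut inside it would
  produce a shorter one.\<close>

lemma skew_decomposition_exists:
  assumes "p \<noteq> []"
  obtains u v where "p = u @ v" "skew_indecomposable u" "\<forall>x\<in>set u. \<forall>y\<in>set v. x > y"
proof -
  define P where "P m \<longleftrightarrow> m > 0 \<and> (\<forall>x\<in>set (take m p). \<forall>y\<in>set (drop m p). x > y)" for m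
  define m where "m = (LEAST m. P m)"
  \<comment> \<open>The whole list dominates the empty remainder, so a least prefix exists;
    \<open>v\<close> is empty when \<open>p\<close> itself is skew indecomposable.\<close>
  have "P (length p)" using assms by (simp add: P_def)
  then have m: "P m" "m \<le> length p" unfolding m_def by (auto intro: LeastI Least_le)
  have "\<not> (\<exists>a b. take m p = a @ b \<and> a \<noteq> [] \<and> b \<noteq> [] \<and> (\<forall>x\<in>set a. \<forall>y\<in>set b. x > y))"
  proof
    assume "\<exists>a b. take m p = a @ b \<and> a \<noteq> [] \<and> b \<noteq> [] \<and> (\<forall>x\<in>set a. \<forall>y\<in>set b. x > y)"
    then obtain a b where ab: "take m p = a @ b" "a \<noteq> []" "b \<noteq> []"
      "\<forall>x\<in>set a. \<forall>y\<in>set b. x > y" by blast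
    have p: "p = a @ b @ drop m p" using ab(1) by (metis append_assoc append_take_drop_id)
    have "take (length a) p = a" "drop (length a) p = b @ drop m p"
      by (subst p, simp)+
    then have "P (length a)" using ab m(1) by (auto simp: P_def)
    then have "m \<le> length a" unfolding m_def by (rule Least_le)
    moreover have "length a + length b = m"
      using arg_cong[OF ab(1), of length] m(2) by simp
    ultimately show False using ab(3) by (cases b) auto
  qed
  then have "skew_indecomposable (take m p)"
    using m assms by (auto simp: skew_indecomposable_def P_def)
  then show thesis using that[of "take m p" "drop m p"] m(1) by (simp add: P_def)
qed

text \<open>Of two such prefixes one extends the other by some \<open>w\<close>. The shorter one
  dominates \<open>w\<close>, so a nonempty \<open>w\<close> would be a skew cut of the longer
  one.\<close>

lemma skew_decomposition_unique:
  assumes "u @ v = u' @ v'" "skew_indecomposable u" "skew_indecomposable u'"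
    and "\<forall>x\<in>set u. \<forall>y\<in>set v. x > y" "\<forall>x\<in>set u'. \<forall>y\<in>set v'. x > y"
  shows "u = u' \<and> v = v'"
proof -
  obtain w where "u = u' @ w \<and> w @ v = v' \<or> u @ w = u' \<and> v = w @ v'"
    using assms(1) by (auto simp: append_eq_append_conv2)
  then show ?thesis
  proof
    assume w: "u = u' @ w \<and> w @ v = v'"
    then have "\<forall>x\<in>set u'. \<forall>y\<in>set w. x > y" using assms(5) by auto
    moreover have "skew_indecomposable (u' @ w)" "u' \<noteq> []"
      using assms(2,3) w by (auto simp: skew_indecomposable_def)
    ultimately have "w = []" unfolding skew_indecomposable_def by blast
    then show ?thesis using w by simp
  next
    assume w: "u @ w = u' \<and> v = w @ v'"
    then have "\<forall>x\<in>set u. \<forall>y\<in>set w. x > y" using assms(4) by auto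
    moreover have "skew_indecomposable (u @ w)" "u \<noteq> []"
      using assms(2,3) w by (auto simp: skew_indecomposable_def)
    ultimately have "w = []" unfolding skew_indecomposable_def by blast
    then show ?thesis using w by simp
  qed
qed

lemma length_permutation: "p \<in> permutations_of_set {1..n} \<Longrightarrow> length p = n"
  by (simp add: length_finite_permutations_of_set)

lemma skew_sum_permutation:
  fixes m l :: nat
  assumes "u \<in> permutations_of_set {1..m}" "v \<in> permutations_of_set {1..l}"
  shows "map ((+) l) u @ v \<in> permutations_of_set {1..m + l}"
proof (rule permutations_of_setI)
  have "(+) l ` {1..m} \<union> {1..l} = {1..m + l}"
    unfolding image_add_atLeastAtMost by auto
  then show "set (map ((+) l) u @ v) = {1..m + l}"
    using assms by (simp add: permutations_of_set_def)
  show "distinct (map ((+) l) u @ v)"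
    using assms by (auto simp: permutations_of_set_def distinct_map)
qed

text \<open>Since \<open>u\<close> lies above \<open>v\<close>, the entries of \<open>v\<close> are
  exactly the smallest values of \<open>{1..n}\<close>. Lowering \<open>u\<close> by
  \<open>length v\<close> then gives a permutation again.\<close>

lemma skew_append_permutationE:
  assumes "u @ v \<in> permutations_of_set {1..n}" "\<forall>x\<in>set u. \<forall>y\<in>set v. x > y"
  obtains u' where "u = map ((+) (length v)) u'"
    "u' \<in> permutations_of_set {1..length u}" "v \<in> permutations_of_set {1..length v}"
proof -
  have d: "distinct u" "distinct v" "set u \<inter> set v = {}" "set u \<union> set v = {1..n}"
    using assms(1) by (auto simp: permutations_of_set_def)
  define l where "l = length v"
  have sv: "set v = {1..l}"
  proof (cases "v = []")
    case False
    define m where "m = Max (set v)"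
    have mv: "m \<in> set v" using False by (simp add: m_def)
    \<comment> \<open>A value below the maximum of \<open>v\<close> cannot occur in
      \<open>u\<close>, whose entries exceed all of \<open>v\<close>.\<close>
    have "set v = {1..m}"
    proof (intro equalityI subsetI)
      fix y assume y: "y \<in> {1..m}"
      have "m \<le> n" using mv d(4) by auto
      then have "y \<in> set u \<union> set v" using y d(4) by auto
      then show "y \<in> set v" using assms(2) mv y by (meson UnE atLeastAtMost_iff not_le)
    next
      fix y assume y: "y \<in> set v"
      then have "y \<in> {1..n}" using d(4) by blast
      then show "y \<in> {1..m}" using y by (simp add: m_def)
    qed
    then show ?thesis using distinct_card[OF d(2)] by (simp add: l_def)
  qed (simp add: l_def)
  have n: "n = length u + l"
    using length_permutation[OF assms(1)] by (simp add: l_def)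
  have "set u = (set u \<union> set v) - set v" using d(3) by blast
  also have "\<dots> = {l + 1..n}" unfolding d(4) unfolding sv by auto
  finally have su: "set u = {l + 1..n}" .
  define u' where "u' = map (\<lambda>x. x - l) u"
  have u: "u = map ((+) l) u'"
    unfolding u'_def map_map by (rule map_idI[symmetric]) (use su in auto)
  have "(+) l ` set u' = set u" by (subst u) simp
  also have "\<dots> = (+) l ` {1..length u}"
    unfolding image_add_atLeastAtMost su n by (simp add: add.commute)
  finally have "set u' = {1..length u}" by (rule inj_image_eq_iff[THEN iffD1, rotated]) simp
  moreover have "distinct (map ((+) l) u')" using d(1) u by simp
  then have "distinct u'" by (simp add: distinct_map)
  ultimately show thesis
    using that[of u'] u sv d(2) unfolding l_def by (simp add: permutations_of_set_def)
qed

section \<open>Counting\<close>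

text \<open>The empty pattern is excluded because it occurs even in the empty list.\<close>

lemma Av_0: "q \<noteq> [] \<Longrightarrow> Av 0 q = 1"
  by (auto simp: Av_def permutations_of_set_def contains_pattern_Nil_iff card_1_singleton_iff
      intro!: exI[of _ "[]"])

lemma Av1_0: "Av1 0 q = 0"
  by (auto simp: Av1_def permutations_of_set_def skew_indecomposable_def)

text \<open>Here \<open>m\<close> is the length of the first skew component; what follows it is an
  arbitrary avoider of length \<open>n - m\<close>. The term for \<open>m = 0\<close> vanishes. At
  \<open>n = 0\<close> the sum would be 0, whereas \<open>Av 0 q\<close> is 1.\<close>

lemma Av_skew_recurrence:
  assumes q: "skew_indecomposable q" and n: "n > 0"
  shows "Av n q = (\<Sum>m=0..n. Av1 m q * Av (n - m) q)"
proof -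
  define B where "B m = {p \<in> permutations_of_set {1..m}. \<not> contains_pattern p q}" for m
  define C where "C m = {p \<in> permutations_of_set {1..m}.
    \<not> contains_pattern p q \<and> skew_indecomposable p}" for m
  \<comment> \<open>The skew sum: \<open>u\<close> is raised by the length of \<open>v\<close>, so
    that it lies above \<open>v\<close>.\<close>
  define f where "f = (\<lambda>(m, u, v). map ((+) (n - m)) u @ v :: nat list)"
  define S where "S = (SIGMA m:{0..n}. C m \<times> B (n - m))"
  have fin: "finite (B m)" "finite (C m)" for m by (auto simp: B_def C_def)
  have smono: "strict_mono ((+) (l :: nat))" for l by (auto simp: strict_mono_def)
  have greater: "\<forall>x\<in>set (map ((+) l) u). \<forall>y\<in>set v. x > y"
    if "u \<in> C m" "v \<in> B l" for u v :: "nat list" and m l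
    using that by (fastforce simp: B_def C_def permutations_of_set_def)
  have "bij_betw f S (B n)"
    unfolding bij_betw_def
  proof (intro conjI equalityI subsetI)
    show "inj_on f S"
    proof (rule inj_onI)
      fix s t assume st: "s \<in> S" "t \<in> S" "f s = f t"
      obtain m u v where s: "s = (m, u, v)" "m \<le> n" "u \<in> C m" "v \<in> B (n - m)"
        using st(1) by (auto simp: S_def)
      obtain m' u' v' where t: "t = (m', u', v')" "m' \<le> n" "u' \<in> C m'" "v' \<in> B (n - m')"
        using st(2) by (auto simp: S_def)
      \<comment> \<open>Both sides are the first component of the same list, so uniqueness of the
        decomposition applies; \<open>m\<close> is then recovered as the length of
        \<open>u\<close>.\<close>
      have "map ((+) (n - m)) u = map ((+) (n - m')) u' \<and> v = v'"
        using st(3) s t greater[OF s(3,4)] greater[OF t(3,4)]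
        by (intro skew_decomposition_unique)
          (auto simp: f_def skew_indecomposable_map[OF smono] C_def)
      moreover from this have "length u = length u'" by (metis length_map)
      then have "m = m'"
        using s(3) t(3) length_permutation[of u m] length_permutation[of u' m'] by (simp add: C_def)
      ultimately show "s = t" using s(1) t(1) by (auto simp: inj_map_eq_map)
    qed
  next
    fix p assume "p \<in> f ` S"
    then obtain m u v where p: "p = map ((+) (n - m)) u @ v" "m \<le> n" "u \<in> C m" "v \<in> B (n - m)"
      by (auto simp: S_def f_def)
    have "p \<in> permutations_of_set {1..m + (n - m)}"
      unfolding p(1) using p by (intro skew_sum_permutation) (auto simp: B_def C_def)
    moreover have "\<not> contains_pattern p q"
      unfolding p(1) using p contains_pattern_skew_append_iff[OF q greater[OF p(3,4)]]
      by (simp add: contains_pattern_map[OF smono] B_def C_def)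
    ultimately show "p \<in> B n" using p(2) by (simp add: B_def)
  next
    fix p assume p: "p \<in> B n"
    then have len: "length p = n" by (simp add: B_def length_permutation)
    then have "p \<noteq> []" using n by auto
    then obtain u v where uv: "p = u @ v" "skew_indecomposable u" "\<forall>x\<in>set u. \<forall>y\<in>set v. x > y"
      by (rule skew_decomposition_exists)
    have "u @ v \<in> permutations_of_set {1..n}" using p uv(1) by (simp add: B_def)
    then obtain u' where u': "u = map ((+) (length v)) u'"
      "u' \<in> permutations_of_set {1..length u}" "v \<in> permutations_of_set {1..length v}"
      using uv(3) by (rule skew_append_permutationE)
    have "\<not> contains_pattern u q" "\<not> contains_pattern v q"
      using p uv contains_pattern_skew_append_iff[OF q uv(3)] by (auto simp: B_def)
    then have "\<not> contains_pattern u' q" "skew_indecomposable u'" "v \<in> B (length v)"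
      using u'(3) uv(2) unfolding u'(1)
      by (simp_all add: B_def contains_pattern_map[OF smono] skew_indecomposable_map[OF smono])
    then have "u' \<in> C (length u)" "v \<in> B (length v)"
      using u'(2) by (simp_all add: C_def)
    moreover have l: "n - length u = length v" "length u \<le> n" using len uv(1) by auto
    ultimately have "(length u, u', v) \<in> S" by (simp add: S_def)
    moreover have "p = f (length u, u', v)"
      unfolding f_def prod.case l(1) u'(1)[symmetric] by (rule uv(1))
    ultimately show "p \<in> f ` S" by blast
  qed
  then have "card (B n) = card S" by (simp add: bij_betw_same_card)
  also have "\<dots> = (\<Sum>m=0..n. card (C m) * card (B (n - m)))"
    unfolding S_def by (subst card_SigmaI) (auto simp: fin card_cartesian_product)
  finally show ?thesis by (simp add: Av_def Av1_def B_def C_def)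
qed

text \<open>Raising all entries by one and putting 1 in front is an injection from the avoiders of
  length \<open>n\<close> into the skew indecomposable avoiders of length
  \<open>Suc n\<close>.\<close>

lemma Av_le_Av1_Suc_hd:
  assumes q: "q \<in> permutations_of_set {1..k}" "q \<noteq> []" "hd q \<noteq> 1"
  shows "Av n q \<le> Av1 (Suc n) q"
  unfolding Av_def Av1_def
proof (rule card_inj_on_le[where f = "\<lambda>p. 1 # map Suc p"])
  have sq: "set q = {1..k}" using q(1) by (simp add: permutations_of_set_def)
  have "hd q \<in> {1..k}" using q(2) sq by (metis hd_in_set)
  then have "1 \<in> set q" using sq by auto
  then obtain s where s: "s < length q" "q ! s = 1" by (auto simp: in_set_conv_nth)
  then have s': "q ! s < q ! 0"
    using q \<open>hd q \<in> {1..k}\<close> by (auto simp: hd_conv_nth)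
  show "(\<lambda>p. 1 # map Suc p) ` {p \<in> permutations_of_set {1..n}. \<not> contains_pattern p q}
    \<subseteq> {p \<in> permutations_of_set {1..Suc n}. \<not> contains_pattern p q \<and> skew_indecomposable p}"
  proof (intro image_subsetI CollectI conjI)
    fix p assume p: "p \<in> {p \<in> permutations_of_set {1..n}. \<not> contains_pattern p q}"
    then have sp: "set p = {1..n}" "distinct p" by (auto simp: permutations_of_set_def)
    then have less: "\<forall>y\<in>set (map Suc p). 1 < y" by auto
    have "set (1 # map Suc p) = {1..Suc n}"
      using sp by (auto simp: image_Suc_atLeastAtMost)
    then show "1 # map Suc p \<in> permutations_of_set {1..Suc n}"
      using sp by (auto simp: permutations_of_set_def distinct_map)
    show "\<not> contains_pattern (1 # map Suc p) q"
      using contains_pattern_min_Cons[OF _ less s(1) s'] p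
      by (auto simp: contains_pattern_map strict_mono_Suc_iff)
    show "skew_indecomposable (1 # map Suc p)"
      by (rule skew_indecomposable_min_Cons[OF less])
  qed
qed (auto simp: inj_on_def)

text \<open>The injection is now appending the new maximum \<open>Suc n\<close>; no relabelling is
  involved.\<close>

lemma Av_le_Av1_Suc_last:
  assumes q: "q \<in> permutations_of_set {1..k}" "q \<noteq> []" "last q \<noteq> k"
  shows "Av n q \<le> Av1 (Suc n) q"
  unfolding Av_def Av1_def
proof (rule card_inj_on_le[where f = "\<lambda>p. p @ [Suc n]"])
  have sq: "set q = {1..k}" using q(1) by (simp add: permutations_of_set_def)
  have "last q \<in> {1..k}" using q(2) sq by (metis last_in_set)
  then have "k \<in> set q" using sq by auto
  then obtain s where s: "s < length q" "q ! s = k" by (auto simp: in_set_conv_nth)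
  then have s': "q ! (length q - 1) < q ! s"
    using q \<open>last q \<in> {1..k}\<close> by (auto simp: last_conv_nth)
  show "(\<lambda>p. p @ [Suc n]) ` {p \<in> permutations_of_set {1..n}. \<not> contains_pattern p q}
    \<subseteq> {p \<in> permutations_of_set {1..Suc n}. \<not> contains_pattern p q \<and> skew_indecomposable p}"
  proof (intro image_subsetI CollectI conjI)
    fix p assume p: "p \<in> {p \<in> permutations_of_set {1..n}. \<not> contains_pattern p q}"
    then have sp: "set p = {1..n}" "distinct p" by (auto simp: permutations_of_set_def)
    then have less: "\<forall>y\<in>set p. y < Suc n" by auto
    show "p @ [Suc n] \<in> permutations_of_set {1..Suc n}"
      using sp by (auto simp: permutations_of_set_def)
    show "\<not> contains_pattern (p @ [Suc n]) q"
      using contains_pattern_append_max[OF _ less s(1) s'] p by auto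
    show "skew_indecomposable (p @ [Suc n])"
      by (rule skew_indecomposable_append_max[OF less])
  qed
qed (auto simp: inj_on_def)

section \<open>Generating functions\<close>

text \<open>In product form, the identity both determines each series from the other and can be
  evaluated at points where both series converge.\<close>

lemma A_gf_mult_eq_1:
  assumes "skew_indecomposable q"
  shows "A_gf q * (1 - A1_gf q) = 1"
proof -
  have "q \<noteq> []" using assms by (simp add: skew_indecomposable_def)
  have A: "A_gf q = 1 + A1_gf q * A_gf q"
  proof (rule fps_ext)
    fix n
    show "fps_nth (A_gf q) n = fps_nth (1 + A1_gf q * A_gf q) n"
    proof (cases "n = 0")
      case True
      then show ?thesis using \<open>q \<noteq> []\<close> by (simp add: A_gf_def A1_gf_def Av_0 Av1_0)
    next
      case False
      then show ?thesis using Av_skew_recurrence[OF assms, of n]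
        by (simp add: A_gf_def A1_gf_def fps_mult_nth)
    qed
  qed
  have "A_gf q * (1 - A1_gf q) = A_gf q - A1_gf q * A_gf q" by (simp add: algebra_simps)
  also have "\<dots> = 1" using A by (metis add_diff_cancel_right')
  finally show ?thesis .
qed

lemma conv_radius_antimono:
  fixes f g :: "nat \<Rightarrow> 'a :: {banach, real_normed_div_algebra}"
  assumes "\<And>n. norm (f n) \<le> norm (g n)"
  shows "conv_radius g \<le> conv_radius f"
proof (rule conv_radius_geI_ex')
  fix r assume r: "0 < r" "ereal r < conv_radius g"
  show "summable (\<lambda>n. f n * of_real r ^ n)"
  proof (rule summable_comparison_test')
    show "summable (\<lambda>n. norm (g n * of_real r ^ n))"
      using r by (intro abs_summable_in_conv_radius) simp
    show "norm (f n * of_real r ^ n) \<le> norm (g n * of_real r ^ n)" for n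
      by (simp add: norm_mult assms mult_right_mono)
  qed
qed

text \<open>Nonnegative coefficients make \<open>G\<close> increasing on the nonnegative reals below
  its radius, so the left limit exists in the extended reals and is the supremum \<open>L\<close>,
  which inherits the bound. Convergence has to be shown first for \<open>Lim\<close> to denote this
  limit.\<close>

lemma value_at_radius_le:
  assumes nonneg: "\<And>n. fps_nth G n \<ge> 0" and R: "fps_conv_radius G > 0"
    and bound: "\<And>x. 0 \<le> x \<Longrightarrow> ereal x < fps_conv_radius G \<Longrightarrow> eval_fps G x \<le> b"
  shows "value_at_radius G \<le> ereal b"
proof -
  let ?R = "fps_conv_radius G"
  let ?g = "\<lambda>x. ereal (eval_fps G (real_of_ereal x))"
  have mono: "eval_fps G x \<le> eval_fps G y" if "0 \<le> x" "x \<le> y" "ereal y < ?R" for x y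
    unfolding eval_fps_def
  proof (intro suminf_le mult_left_mono power_mono nonneg that(1,2))
    show "summable (\<lambda>n. fps_nth G n * y ^ n)" "summable (\<lambda>n. fps_nth G n * x ^ n)"
      using that by (auto intro!: summable_fps order.strict_trans1[of "ereal x" "ereal y"])
  qed
  \<comment> \<open>The strict bounds exclude both infinities, which \<open>real_of_ereal\<close>
    would send to 0; this also covers an infinite radius.\<close>
  have real: "ereal (real_of_ereal x) = x" if "0 < x" "x < ?R" for x
    using that by (cases x) auto
  define L where "L = (SUP x\<in>{0<..<?R}. ?g x)"
  have inside: "eventually (\<lambda>x. x \<in> {z<..<?R}) (at_left ?R)" if "z < ?R" for z
    using that by (intro eventually_at_leftI[of z]) auto
  have "(?g \<longlongrightarrow> L) (at_left ?R)"
  proof (rule increasing_tendsto)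
    show "eventually (\<lambda>x. ?g x \<le> L) (at_left ?R)"
      using inside[OF R] by eventually_elim (auto simp: L_def intro: SUP_upper)
    fix y assume "y < L"
    then obtain z where z: "z \<in> {0<..<?R}" "y < ?g z"
      by (auto simp: L_def less_SUP_iff)
    have "z < ?R" using z by simp
    from inside[OF this] show "eventually (\<lambda>x. y < ?g x) (at_left ?R)"
    proof eventually_elim
      case (elim x)
      then have x: "z \<le> x" "0 < x" "x < ?R" using z by (auto simp: less_imp_le)
      have z_real: "ereal (real_of_ereal z) = z" and x_real: "ereal (real_of_ereal x) = x"
        using z(1) x by (auto intro: real)
      have "ereal (real_of_ereal z) \<le> ereal (real_of_ereal x)"
        unfolding z_real x_real by (rule x(1))
      then have le: "real_of_ereal z \<le> real_of_ereal x" by simp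
      have "eval_fps G (real_of_ereal z) \<le> eval_fps G (real_of_ereal x)"
      proof (rule mono)
        show "0 \<le> real_of_ereal z" using z(1) by (intro real_of_ereal_pos) (simp add: less_imp_le)
        show "real_of_ereal z \<le> real_of_ereal x" by (rule le)
        show "ereal (real_of_ereal x) < ?R" unfolding x_real by (rule x(3))
      qed
      then have "?g z \<le> ?g x" by simp
      then show ?case using z(2) by (rule less_le_trans[rotated])
    qed
  qed
  \<comment> \<open>Nontriviality of the filter makes the limit unique, so \<open>Lim\<close>
    selects \<open>L\<close>.\<close>
  moreover have "at_left ?R \<noteq> bot"
    unfolding trivial_limit_def eventually_at_left[OF R] using dense by blast
  ultimately have "value_at_radius G = L"
    unfolding value_at_radius_def by (intro tendsto_Lim)
  also have "L \<le> ereal b" unfolding L_def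
    using real by (auto intro!: SUP_least bound simp: real_of_ereal_pos less_imp_le)
  finally show ?thesis .
qed

text \<open>Assuming only the coefficient inequality treats the condition on the first letter and
  the one on the last letter of \<open>q\<close> together.\<close>

lemma not_supercriticalI:
  assumes q: "skew_indecomposable q" and le: "\<And>n. Av n q \<le> Av1 (Suc n) q"
  shows "\<not> supercritical (A1_gf q)"
proof
  let ?A = "A_gf q" and ?G = "A1_gf q"
  assume "supercritical ?G"
  then have R: "fps_conv_radius ?G > 0" and gt: "value_at_radius ?G > 1"
    by (auto simp: supercritical_def)
  have "eval_fps ?G x \<le> 1" if x: "0 \<le> x" "ereal x < fps_conv_radius ?G" for x
  proof -
    have radius: "fps_conv_radius ?G \<le> fps_conv_radius ?A"
    proof -
      \<comment> \<open>The coefficients of \<open>?A\<close> are compared with those of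
        \<open>?G\<close> shifted by one place, and a shift preserves the radius.\<close>
      have "conv_radius (\<lambda>n. fps_nth ?G (Suc n)) \<le> conv_radius (fps_nth ?A)"
        by (rule conv_radius_antimono) (auto simp: A_gf_def A1_gf_def le)
      then show ?thesis
        using conv_radius_shift[of "fps_nth ?G" 1] by (simp add: fps_conv_radius_def)
    qed
    then have xA: "ereal (norm x) < fps_conv_radius ?A" using x by auto
    have xG: "ereal (norm x) < fps_conv_radius (1 - ?G)"
      using x fps_conv_radius_diff[of 1 ?G] by auto
    have "eval_fps ?A x * (1 - eval_fps ?G x) = 1"
      using A_gf_mult_eq_1[OF q] eval_fps_mult[OF xA xG] eval_fps_diff[of x 1 ?G] x by simp
    moreover have "eval_fps ?A x \<ge> 0"
      unfolding eval_fps_def using x xA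
      by (intro suminf_nonneg summable_fps) (auto simp: A_gf_def)
    \<comment> \<open>A nonnegative factor in a product equal to 1 is positive, hence so is the
      other factor.\<close>
    ultimately have "1 - eval_fps ?G x > 0"
      by (metis less_eq_real_def mult_zero_left zero_less_mult_pos zero_less_one zero_neq_one)
    then show ?thesis by simp
  qed
  \<comment> \<open>Only the weak inequality survives in the limit, and it already contradicts a
    value strictly above 1.\<close>
  then have "value_at_radius ?G \<le> ereal 1"
    by (intro value_at_radius_le R) (auto simp: A1_gf_def)
  with gt[unfolded one_ereal_def] have "ereal 1 < ereal 1" by (rule less_le_trans)
  then show False by simp
qed

theorem theorem6p2:
  fixes q :: "nat list" and k :: nat
  assumes "q \<in> permutations_of_set {1..k}"
    and "skew_indecomposable q"
    and "hd q \<noteq> 1 \<or> last q \<noteq> k \<or>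
         (hd q = 1 \<and> last q = k \<and>
          (\<exists>q'. q' \<in> permutations_of_set {1..k} \<and> skew_indecomposable q' \<and>
                wilf_equivalent q q' \<and> (hd q' \<noteq> 1 \<or> last q' \<noteq> k)))"
  shows "A_gf q = 1 / (1 - A1_gf q) \<and> \<not> supercritical (A1_gf q)"
proof
  \<comment> \<open>This recovers \<open>A1_gf r\<close> from \<open>A_gf r\<close>, which carries
    the result across Wilf equivalence.\<close>
  have A1_eq: "1 - A1_gf r = inverse (A_gf r)" if "skew_indecomposable r" for r
    using fps_inverse_unique[OF A_gf_mult_eq_1[OF that]] by simp
  have "A_gf q = inverse (1 - A1_gf q)"
    using fps_inverse_unique[of "1 - A1_gf q" "A_gf q"] A_gf_mult_eq_1[OF assms(2)]
    by (simp add: mult.commute)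
  \<comment> \<open>The denominator is a unit, so the quotient of formal power series is
    multiplication by its inverse.\<close>
  moreover have "fps_nth (1 - A1_gf q) 0 \<noteq> 0" by (simp add: A1_gf_def Av1_0)
  ultimately show "A_gf q = 1 / (1 - A1_gf q)" by (simp add: fps_divide_unit)
  have not_super: "\<not> supercritical (A1_gf r)"
    if r: "r \<in> permutations_of_set {1..k}" "skew_indecomposable r" "hd r \<noteq> 1 \<or> last r \<noteq> k" for r
  proof (rule not_supercriticalI[OF r(2)])
    have "r \<noteq> []" using r(2) by (simp add: skew_indecomposable_def)
    then show "Av n r \<le> Av1 (Suc n) r" for n
      using r Av_le_Av1_Suc_hd Av_le_Av1_Suc_last by blast
  qed
  show "\<not> supercritical (A1_gf q)"
  proof (cases "hd q \<noteq> 1 \<or> last q \<noteq> k")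
    case True
    then show ?thesis using not_super assms(1,2) by blast
  next
    case False
    then obtain q' where q': "q' \<in> permutations_of_set {1..k}" "skew_indecomposable q'"
      "wilf_equivalent q q'" "hd q' \<noteq> 1 \<or> last q' \<noteq> k"
      using assms(3) by blast
    have "q \<noteq> []" "q' \<noteq> []" using assms(2) q'(2) by (auto simp: skew_indecomposable_def)
    \<comment> \<open>Wilf equivalence covers \<open>n \<ge> 1\<close>; at \<open>n = 0\<close> both
      counts are 1 because the patterns are nonempty.\<close>
    then have "Av n q = Av n q'" for n
      using q'(3) by (cases "n = 0") (auto simp: wilf_equivalent_def Av_0)
    then have "A_gf q = A_gf q'" by (simp add: A_gf_def)
    then have "1 - A1_gf q = 1 - A1_gf q'" using A1_eq assms(2) q'(2) by metis
    then have "A1_gf q = A1_gf q'" by simp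
    then show ?thesis using not_super[OF q'(1,2,4)] by simp
  qed
qed

end
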